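(* Let $E$ be the nested logit surplus function with nests $N_1,\dots,N_L$ and nest parameters $\mu_1,\dots,\mu_L\in(0,1]$. Then the modulus of strong convexity of its convex conjugate $E^\star:\triangle\to\mathbb{R}$ with respect to the norm $\|\cdot\|_1$ is $\beta=\min_{1\le\ell\le L}\mu_\ell$.
   Context: The set $\{1,\dots,n\}$ of alternatives is partitioned into nonempty nests $N_1,\dots,N_L$ (each alternative belongs to exactly one nest), with parameters $0<\mu_\ell\le 1$. The nested logit surplus function is $E:\mathbb{R}^n\to\mathbb{R}$, $$E(v)=\ln\left(\sum_{\ell=1}^{L}\Big(\sum_{i\in N_\ell}e^{v^{(i)}/\mu_\ell}\Big)^{\mu_\ell}\right).$$ Let $\triangle=\{q\in\mathbb{R}^n: q^{(i)}\ge0,\ \sum_{i=1}^n q^{(i)}=1\}$ and $\|x\|_1=\sum_i|x^{(i)}|$. The convex conjugate is $E^\star(q)=\sup_{v\in\mathbb{R}^n}\langle v,q\rangle-E(v)$, considered on $\triangle$; it is known to be given there (with $0\ln 0=0$) by $$E^\star(q)=\sum_{\ell=1}^{L}\mu_\ell\sum_{i\in N_\ell}q^{(i)}\ln q^{(i)}+\sum_{\ell=1}^{L}(1-\mu_\ell)\Big(\sum_{i\in N_\ell}q^{(i)}\Big)\ln\Big(\sum_{i\in N_\ell}q^{(i)}\Big).$$ $E^\star$ is $\beta$-strongly convex with respect to $\|\cdot\|_1$ if for all $q,\bar q\in\triangle$ and $\lambda\in[0,1]$, $$E^\star(\lambda q+(1-\lambda)\bar q)\le\lambda E^\star(q)+(1-\lambda)E^\star(\bar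 q)-\frac{\beta}{2}\lambda(1-\lambda)\|q-\bar q\|_1^2 .$$ The biggest constant $\beta>0$ with this property is called the modulus of strong convexity of $E^\star$.
   Formalization: Added: n ≥ 2 (for n = 1 no biggest constant exists), and some nest attaining min μ_ℓ has at least two alternatives or min μ_ℓ = 1; otherwise false, e.g. two singleton nests with μ = 1/2 have modulus 1. *)

theory Defs
  imports "HOL-Analysis.Analysis"
begin

text \<open>
  Alternatives are the elements of the finite type \<^typ>\<open>'n\<close>, and points of \<open>R^n\<close> are elements of
  \<^typ>\<open>real ^ 'n\<close>. Nests are given by a family \<open>N\<close> of sets of alternatives indexed by \<open>{1..L}\<close>.
\<close>

definition nest_partition :: "nat \<Rightarrow> (nat \<Rightarrow> 'n set) \<Rightarrow> bool" where
  "nest_partition L N \<longleftrightarrow>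
     (\<forall>l\<in>{1..L}. N l \<noteq> {}) \<and> disjoint_family_on N {1..L} \<and> (\<Union>l\<in>{1..L}. N l) = UNIV"

definition nested_logit_surplus ::
    "nat \<Rightarrow> (nat \<Rightarrow> 'n set) \<Rightarrow> (nat \<Rightarrow> real) \<Rightarrow> real ^ 'n::finite \<Rightarrow> real" where
  "nested_logit_surplus L N \<mu> v =
     ln (\<Sum>l=1..L. (\<Sum>i\<in>N l. exp (v $ i / \<mu> l)) powr \<mu> l)"

definition prob_simplex :: "(real ^ 'n::finite) set" where
  "prob_simplex = {q. (\<forall>i. 0 \<le> q $ i) \<and> (\<Sum>i\<in>UNIV. q $ i) = 1}"

definition l1_norm :: "real ^ 'n::finite \<Rightarrow> real" where
  "l1_norm x = (\<Sum>i\<in>UNIV. \<bar>x $ i\<bar>)"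

text \<open>
  The supremum is taken in \<^typ>\<open>real\<close>, so the definition is meaningful only at those \<open>q\<close> where
  \<open>v \<bullet> q - f v\<close> is bounded above in \<open>v\<close>. For the nested logit surplus this covers the
  whole simplex, see \<open>bdd_above_conjugate_nested_logit\<close> below.
\<close>

definition convex_conjugate :: "('a::real_inner \<Rightarrow> real) \<Rightarrow> 'a \<Rightarrow> real" where
  "convex_conjugate f q = (SUP v. v \<bullet> q - f v)"

definition strongly_convex_on ::
    "'a::real_vector set \<Rightarrow> ('a \<Rightarrow> real) \<Rightarrow> ('a \<Rightarrow> real) \<Rightarrow> real \<Rightarrow> bool" where
  "strongly_convex_on S nrm f \<beta> \<longleftrightarrow>
     (\<forall>q\<in>S. \<forall>q'\<in>S. \<forall>t\<in>{0..1}.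
        f (t *\<^sub>R q + (1 - t) *\<^sub>R q') \<le>
          t * f q + (1 - t) * f q' - \<beta> / 2 * t * (1 - t) * (nrm (q - q'))\<^sup>2)"

text \<open>A relation and not a function, because a biggest constant need not exist.\<close>

definition is_strong_convexity_modulus ::
    "'a::real_vector set \<Rightarrow> ('a \<Rightarrow> real) \<Rightarrow> ('a \<Rightarrow> real) \<Rightarrow> real \<Rightarrow> bool" where
  "is_strong_convexity_modulus S nrm f \<beta> \<longleftrightarrow>
     0 < \<beta> \<and> strongly_convex_on S nrm f \<beta> \<and>
     (\<forall>\<gamma>>0. strongly_convex_on S nrm f \<gamma> \<longrightarrow> \<gamma> \<le> \<beta>)"

lemma component_le_nested_logit_surplus:
  fixes N :: "nat \<Rightarrow> 'n::finite set"
  assumes part: "nest_partition L N" and pos: "\<And>l. l \<in> {1..L} \<Longrightarrow> 0 < \<mu> l"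
  shows "v $ i \<le> nested_logit_surplus L N \<mu> v"
proof -
  obtain l where l: "l \<in> {1..L}" "i \<in> N l"
    using part unfolding nest_partition_def by blast
  let ?g = "\<lambda>l. \<Sum>i\<in>N l. exp (v $ i / \<mu> l)"
  have "exp (v $ i / \<mu> l) \<le> ?g l"
    using l by (intro member_le_sum) auto
  then have "exp (v $ i / \<mu> l) powr \<mu> l \<le> ?g l powr \<mu> l"
    using pos[OF l(1)] by (intro powr_mono2) auto
  then have "exp (v $ i) \<le> ?g l powr \<mu> l"
    using pos[OF l(1)] by (simp add: powr_def)
  also have "\<dots> \<le> (\<Sum>l=1..L. ?g l powr \<mu> l)"
    using l(1) by (intro member_le_sum[where f = "\<lambda>l. ?g l powr \<mu> l"]) auto
  finally have le: "exp (v $ i) \<le> (\<Sum>l=1..L. ?g l powr \<mu> l)" .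
  then have "0 < (\<Sum>l=1..L. ?g l powr \<mu> l)"
    using exp_gt_zero[of "v $ i"] by linarith
  with le show ?thesis
    unfolding nested_logit_surplus_def by (simp add: ln_ge_iff)
qed

lemma bdd_above_conjugate_nested_logit:
  fixes N :: "nat \<Rightarrow> 'n::finite set"
  assumes part: "nest_partition L N" and pos: "\<And>l. l \<in> {1..L} \<Longrightarrow> 0 < \<mu> l"
    and q: "q \<in> prob_simplex"
  shows "bdd_above (range (\<lambda>v. v \<bullet> q - nested_logit_surplus L N \<mu> v))"
proof (rule bdd_aboveI2)
  fix v :: "real ^ 'n"
  let ?E = "nested_logit_surplus L N \<mu> v"
  have le: "v $ i \<le> ?E" for i
    by (rule component_le_nested_logit_surplus[OF part]) (rule pos)
  have "v \<bullet> q = (\<Sum>i\<in>UNIV. v $ i * q $ i)"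
    by (simp add: inner_vec_def)
  also have "\<dots> \<le> (\<Sum>i\<in>UNIV. ?E * q $ i)"
    using q by (intro sum_mono mult_right_mono le) (simp add: prob_simplex_def)
  also have "\<dots> = ?E"
    using q by (simp add: prob_simplex_def flip: sum_distrib_left)
  finally show "v \<bullet> q - ?E \<le> 0" by simp
qed

end

theory Submission
  imports Defs "HOL-Real_Asymp.Real_Asymp"
begin

text \<open>
  Applying the log-sum inequality within each nest and then across nests gives the closed form of the
  conjugate. With \<open>m\<close> the smallest nest parameter, this closed form is \<open>m \<Sum> q\<^sub>i ln q\<^sub>i\<close> plus nonnegative
  multiples of convex terms \<open>x ln x\<close>, and the negative entropy is 1-strongly convex for the 1-norm by
  Pinsker's inequality. The constant cannot be improved: on an edge of the simplex joining two
  alternatives of a nest with parameter \<open>m\<close> (any two alternatives if \<open>m = 1\<close>), the conjugate is \<open>m\<close> times the binary negative entropy,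
  for which the constant 1 is sharp at the midpoint.
\<close>

section \<open>Pinsker's inequality in a single coordinate\<close>

text \<open>The difference of the two sides is convex on the positive reals and vanishes to first
  order at 1. The denominator is fitted to Pinsker's inequality: in the homogeneous version the
  weights \<open>2 * x + 4 * m\<close> sum to 6 over two probability vectors, which gives the sharp
  constant.\<close>

lemma pinsker_pointwise_unit:
  fixes x :: real
  assumes "0 < x"
  shows "3 * (x - 1)\<^sup>2 / (2 * x + 4) \<le> x * ln x - x + 1"
proof -
  \<comment> \<open>Partial fractions, from
    \<open>(x - 1)^2 = (x + 2) * (x - 4) + 9\<close>.\<close>
  define f where "f x = x * ln x - x + 1 - 3 / 2 * (x - 4) - 27 / 2 * inverse (x + 2)" for x :: real
  define f' where "f' x = ln x - 3 / 2 + 27 / 2 * inverse (x + 2) ^ 2" for x :: real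
  define f'' where "f'' x = inverse x - 27 * inverse (x + 2) ^ 3" for x :: real
  have "f' 1 * (x - 1) \<le> f x - f 1"
  proof (rule f''_imp_f'[where C = "{0<..}" and f'' = f''])
    show "(f has_real_derivative f' y) (at y)" if "y \<in> {0<..}" for y
      unfolding f_def f'_def using that
      by (auto intro!: derivative_eq_intros simp: power2_eq_square)
    show "(f' has_real_derivative f'' y) (at y)" if "y \<in> {0<..}" for y
      unfolding f'_def f''_def using that
      by (auto intro!: derivative_eq_intros simp: power3_eq_cube inverse_eq_divide[of y])
    show "0 \<le> f'' y" if "y \<in> {0<..}" for y
    proof -
      \<comment> \<open>This is AM-GM for \<open>y\<close>, 1, 1, with its double root at 1.\<close>
      have "(y + 2) ^ 3 - 27 * y = (y - 1)\<^sup>2 * (y + 8)" by algebra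
      also have "\<dots> \<ge> 0" using that by simp
      finally have "27 * y \<le> (y + 2) ^ 3" by simp
      then show ?thesis using that by (simp add: f''_def divide_simps)
    qed
  qed (use assms in auto)
  moreover have "f x = x * ln x - x + 1 - 3 * (x - 1)\<^sup>2 / (2 * x + 4)"
    using assms by (simp add: f_def divide_simps) algebra
  moreover have "f 1 = 0" "f' 1 = 0" by (simp_all add: f_def f'_def power2_eq_square)
  ultimately show ?thesis by simp
qed

text \<open>
  For \<open>s = 0\<close> this is the tangent inequality of \<open>x ln x\<close>. The term \<open>2 s \<bar>x - m\<bar> - s\<^sup>2 (2 x + 4 m) / 3\<close>
  is linear in \<open>(x, m, \<bar>x - m\<bar>)\<close> and its supremum over \<open>s\<close> is \<open>3 (x - m)\<^sup>2 / (2 x + 4 m)\<close>; choosing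
  \<open>s\<close> after summation replaces the Cauchy-Schwarz step of Pinsker's inequality.
\<close>

lemma pinsker_pointwise:
  fixes x m s :: real
  assumes "0 \<le> x" "0 < m"
  shows "x * ln m + x - m + 2 * s * \<bar>x - m\<bar> - s\<^sup>2 * (2 * x + 4 * m) / 3 \<le> x * ln x"
proof -
  let ?a = "\<bar>x - m\<bar>" and ?b = "2 * x + 4 * m"
  have b: "0 < ?b" using assms by simp
  have "2 * s * a - s\<^sup>2 * b / 3 \<le> 3 * a\<^sup>2 / b" if "0 < b" for a b :: real
  proof -
    have "0 \<le> (3 * a - s * b)\<^sup>2 / (3 * b)" using that by simp
    also have "\<dots> = 3 * a\<^sup>2 / b - 2 * s * a + s\<^sup>2 * b / 3"
      using that by (simp add: divide_simps) algebra
    finally show ?thesis by simp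
  qed
  from this[OF b, of ?a] have 1: "2 * s * ?a - s\<^sup>2 * ?b / 3 \<le> 3 * (x - m)\<^sup>2 / ?b" by simp
  have 2: "3 * (x - m)\<^sup>2 / ?b \<le> x * ln x - x * ln m - x + m"
  proof (cases "x = 0")
    case True
    then show ?thesis using assms by (simp add: power2_eq_square)
  next
    case False
    then have x: "0 < x" using assms by simp
    \<comment> \<open>Both sides are homogeneous of degree one in \<open>(x, m)\<close>, which
      reduces the claim to \<open>m = 1\<close>.\<close>
    have "m * (3 * (x / m - 1)\<^sup>2 / (2 * (x / m) + 4)) \<le> m * (x / m * ln (x / m) - x / m + 1)"
      using x assms by (intro mult_left_mono pinsker_pointwise_unit) auto
    also have "\<dots> = x * ln x - x * ln m - x + m"
      using x assms by (simp add: ln_div algebra_simps)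
    also have "m * (3 * (x / m - 1)\<^sup>2 / (2 * (x / m) + 4)) = 3 * (x - m)\<^sup>2 / ?b"
    proof -
      have "x / m - 1 = (x - m) / m" "2 * (x / m) + 4 = ?b / m"
        using assms by (simp_all add: field_simps)
      then show ?thesis using assms b by (simp only: power_divide) (simp add: power2_eq_square)
    qed
    finally show ?thesis .
  qed
  from 1 2 show ?thesis by linarith
qed

section \<open>Log-sum inequality and convexity of \<open>x ln x\<close>\<close>

text \<open>Apply the tangent inequality of \<open>x ln x\<close> at the numbers \<open>a i\<close>
  rescaled to total mass \<open>sum q A\<close>; the linear terms then cancel in the sum.\<close>

lemma log_sum_inequality:
  fixes q a :: "'a \<Rightarrow> real"
  assumes fin: "finite A" and q: "\<And>i. i \<in> A \<Longrightarrow> 0 \<le> q i" and a: "\<And>i. i \<in> A \<Longrightarrow> 0 < a i"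
  shows "(\<Sum>i\<in>A. q i * ln (a i)) \<le>
    sum q A * ln (sum a A) + (\<Sum>i\<in>A. q i * ln (q i)) - sum q A * ln (sum q A)"
proof (cases "sum q A = 0")
  case True
  then have "\<forall>i\<in>A. q i = 0" using fin q by (simp add: sum_nonneg_eq_0_iff)
  then show ?thesis by simp
next
  case False
  let ?Q = "sum q A" and ?S = "sum a A"
  have Q: "0 < ?Q" using False sum_nonneg[of A q] q by fastforce
  then have "A \<noteq> {}" by auto
  then have S: "0 < ?S" using fin a by (intro sum_pos) auto
  have "(\<Sum>i\<in>A. q i * ln (a i * ?Q / ?S) + q i - a i * ?Q / ?S) \<le> (\<Sum>i\<in>A. q i * ln (q i))"
    using pinsker_pointwise[where s = 0] q a Q S by (intro sum_mono) fastforce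
  also have "(\<Sum>i\<in>A. q i * ln (a i * ?Q / ?S) + q i - a i * ?Q / ?S) =
      (\<Sum>i\<in>A. q i * ln (a i) + q i * (ln ?Q - ln ?S) + q i - a i * (?Q / ?S))"
    using a Q S by (intro sum.cong refl) (simp add: ln_div ln_mult algebra_simps less_imp_neq[symmetric])
  also have "\<dots> = (\<Sum>i\<in>A. q i * ln (a i)) + ?Q * (ln ?Q - ln ?S) + ?Q - ?S * (?Q / ?S)"
    unfolding sum.distrib sum_subtractf sum_distrib_right ..
  finally show ?thesis using S by (simp add: algebra_simps)
qed

text \<open>Average \<open>pinsker_pointwise\<close> at \<open>x\<close> and \<open>y\<close> around
  their mean \<open>m\<close>; the deviations from \<open>m\<close> cancel. The parameter
  \<open>r\<close> stays free so that one value can serve all coordinates.\<close>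

lemma x_ln_x_strong_convexity:
  fixes x y t r :: real
  assumes "0 \<le> x" "0 \<le> y" "0 \<le> t" "t \<le> 1"
  defines "m \<equiv> t * x + (1 - t) * y"
  shows "m * ln m + t * (1 - t) * (2 * r * \<bar>x - y\<bar> - r\<^sup>2 * (2 * (1 - t) * x + 2 * t * y + 4 * m) / 3)
    \<le> t * (x * ln x) + (1 - t) * (y * ln y)"
proof (cases "t = 0 \<or> t = 1")
  case True
  then show ?thesis by (auto simp: m_def)
next
  case False
  then have t: "0 < t" "t < 1" using assms by auto
  have m0: "0 \<le> m" using assms by (simp add: m_def)
  show ?thesis
  proof (cases "m = 0")
    case True
    then have "t * x = 0 \<and> (1 - t) * y = 0"
      using assms by (simp add: m_def add_nonneg_eq_0_iff)
    then show ?thesis using t True by auto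
  next
    case False
    then have m: "0 < m" using m0 by simp
    have xm: "x - m = (1 - t) * (x - y)" and ym: "y - m = - (t * (x - y))"
      by (simp_all add: m_def algebra_simps)
    have ax: "\<bar>x - m\<bar> = (1 - t) * \<bar>x - y\<bar>" and ay: "\<bar>y - m\<bar> = t * \<bar>x - y\<bar>"
      unfolding xm ym using t by (simp_all add: abs_mult)
    define d where "d = \<bar>x - y\<bar>"
    \<comment> \<open>The parameters \<open>(1 - t) * r\<close> and \<open>t * r\<close> are crossed
      with the weights \<open>t\<close> and \<open>1 - t\<close>, so that \<open>t * (1 - t)\<close>
      factors out of both the linear and the quadratic term in \<open>r\<close>.\<close>
    let ?X = "x * ln m + x - m + 2 * ((1 - t) * r) * \<bar>x - m\<bar> - ((1 - t) * r)\<^sup>2 * (2 * x + 4 * m) / 3"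
    let ?Y = "y * ln m + y - m + 2 * (t * r) * \<bar>y - m\<bar> - (t * r)\<^sup>2 * (2 * y + 4 * m) / 3"
    have "t * ?X + (1 - t) * ?Y \<le> t * (x * ln x) + (1 - t) * (y * ln y)"
      using pinsker_pointwise[OF assms(1) m, of "(1 - t) * r"]
        pinsker_pointwise[OF assms(2) m, of "t * r"] t
      by (intro add_mono mult_left_mono) auto
    moreover have "t * ?X + (1 - t) * ?Y = m * ln m +
        t * (1 - t) * (2 * r * \<bar>x - y\<bar> - r\<^sup>2 * (2 * (1 - t) * x + 2 * t * y + 4 * m) / 3)"
      unfolding ax ay unfolding d_def[symmetric] m_def by (simp add: field_simps power2_eq_square)
    ultimately show ?thesis by simp
  qed
qed

lemma x_ln_x_convexity:
  fixes x y t :: real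
  assumes "0 \<le> x" "0 \<le> y" "0 \<le> t" "t \<le> 1"
  shows "(t * x + (1 - t) * y) * ln (t * x + (1 - t) * y) \<le> t * (x * ln x) + (1 - t) * (y * ln y)"
  using x_ln_x_strong_convexity[OF assms, of 0] by simp

section \<open>Closed form of the conjugate\<close>

text \<open>The known formula for the conjugate on the simplex. Products \<open>0 * ln 0\<close> are
  0, so it is meant on the boundary too.\<close>

definition nested_entropy :: "nat \<Rightarrow> (nat \<Rightarrow> 'n set) \<Rightarrow> (nat \<Rightarrow> real) \<Rightarrow> real ^ 'n::finite \<Rightarrow> real" where
  "nested_entropy L N \<mu> q =
     (\<Sum>l=1..L. \<mu> l * (\<Sum>i\<in>N l. q $ i * ln (q $ i))
       + (1 - \<mu> l) * ((\<Sum>i\<in>N l. q $ i) * ln (\<Sum>i\<in>N l. q $ i)))"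

lemma nest_partition_unique:
  assumes "nest_partition L N" "l \<in> {1..L}" "i \<in> N l" "l' \<in> {1..L}" "i \<in> N l'"
  shows "l = l'"
  using assms unfolding nest_partition_def disjoint_family_on_def by blast

lemma sum_nests:
  fixes N :: "nat \<Rightarrow> 'n::finite set" and f :: "'n \<Rightarrow> 'a::comm_monoid_add"
  assumes "nest_partition L N"
  shows "(\<Sum>l=1..L. \<Sum>i\<in>N l. f i) = (\<Sum>i\<in>UNIV. f i)"
proof -
  have "(\<Sum>i\<in>(\<Union>l\<in>{1..L}. N l). f i) = (\<Sum>l=1..L. \<Sum>i\<in>N l. f i)"
    using assms by (intro sum.UNION_disjoint) (auto simp: nest_partition_def disjoint_family_on_def)
  then show ?thesis using assms by (simp add: nest_partition_def)
qed

lemma convex_prob_simplex: "convex (prob_simplex :: (real ^ 'n::finite) set)"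
  unfolding convex_def prob_simplex_def
  by (auto simp: sum.distrib simp flip: sum_distrib_left)

lemma fenchel_young_nested_logit:
  fixes N :: "nat \<Rightarrow> 'n::finite set"
  assumes part: "nest_partition L N" and pos: "\<And>l. l \<in> {1..L} \<Longrightarrow> 0 < \<mu> l"
    and q: "q \<in> prob_simplex"
  shows "v \<bullet> q - nested_logit_surplus L N \<mu> v \<le> nested_entropy L N \<mu> q"
proof -
  define Q where "Q l = (\<Sum>i\<in>N l. q $ i)" for l
  define S where "S l = (\<Sum>i\<in>N l. exp (v $ i / \<mu> l))" for l
  define h where "h l = (\<Sum>i\<in>N l. q $ i * ln (q $ i))" for l
  have q0: "0 \<le> q $ i" for i using q by (simp add: prob_simplex_def)
  have sumQ: "(\<Sum>l=1..L. Q l) = 1"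
    unfolding Q_def sum_nests[OF part] using q by (simp add: prob_simplex_def)
  have Q0: "0 \<le> Q l" for l unfolding Q_def by (intro sum_nonneg q0)
  have S0: "0 < S l" if "l \<in> {1..L}" for l
    unfolding S_def using part that by (intro sum_pos) (auto simp: nest_partition_def)
  have inner: "(\<Sum>i\<in>N l. v $ i * q $ i) \<le> Q l * ln (S l powr \<mu> l) + \<mu> l * h l - \<mu> l * (Q l * ln (Q l))"
    if l: "l \<in> {1..L}" for l
  proof -
    \<comment> \<open>The weights are \<open>exp (v $ i / \<mu> l)\<close>; scaling by
      \<open>\<mu> l\<close> then recovers \<open>v $ i\<close> and turns \<open>ln (S l)\<close>
      into \<open>ln (S l powr \<mu> l)\<close>.\<close>
    have "(\<Sum>i\<in>N l. q $ i * ln (exp (v $ i / \<mu> l))) \<le> Q l * ln (S l) + h l - Q l * ln (Q l)"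
      unfolding Q_def S_def h_def by (intro log_sum_inequality q0) auto
    then have "\<mu> l * (\<Sum>i\<in>N l. q $ i * (v $ i / \<mu> l)) \<le> \<mu> l * (Q l * ln (S l) + h l - Q l * ln (Q l))"
      using pos[OF l] by simp
    moreover have "\<mu> l * (\<Sum>i\<in>N l. q $ i * (v $ i / \<mu> l)) = (\<Sum>i\<in>N l. v $ i * q $ i)"
      using pos[OF l] by (simp add: sum_distrib_left mult.commute)
    ultimately show ?thesis using S0[OF l] by (simp add: ln_powr algebra_simps)
  qed
  \<comment> \<open>The weights \<open>S l powr \<mu> l\<close> sum to the exponential of the
    surplus; the nest masses sum to 1, so the term \<open>1 * ln 1\<close> drops out.\<close>
  have outer: "(\<Sum>l=1..L. Q l * ln (S l powr \<mu> l)) \<le>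
      nested_logit_surplus L N \<mu> v + (\<Sum>l=1..L. Q l * ln (Q l))"
    using log_sum_inequality[of "{1..L}" Q "\<lambda>l. S l powr \<mu> l"] Q0 S0 sumQ
    by (simp add: nested_logit_surplus_def S_def less_imp_neq[symmetric])
  have "v \<bullet> q = (\<Sum>l=1..L. \<Sum>i\<in>N l. v $ i * q $ i)"
    by (simp add: inner_vec_def sum_nests[OF part] del: One_nat_def)
  also have "\<dots> \<le> (\<Sum>l=1..L. Q l * ln (S l powr \<mu> l) + \<mu> l * h l - \<mu> l * (Q l * ln (Q l)))"
    by (intro sum_mono inner)
  also have "\<dots> \<le> nested_logit_surplus L N \<mu> v +
      (\<Sum>l=1..L. \<mu> l * h l + (1 - \<mu> l) * (Q l * ln (Q l)))"
    using outer by (simp add: sum.distrib sum_subtractf algebra_simps)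
  finally show ?thesis by (simp add: nested_entropy_def Q_def h_def)
qed

text \<open>
  At an interior point \<open>p\<close> the supremum is attained at \<open>v\<^sub>i = \<mu>\<^sub>l ln p\<^sub>i + (1 - \<mu>\<^sub>l) ln P\<^sub>l\<close>, normalised
  so that \<open>E v = 0\<close>. On the boundary, use this \<open>v\<close> for a mixture \<open>p\<close> of \<open>q\<close> and the uniform point.
\<close>

lemma conjugate_nested_logit_ge_perturbed:
  fixes N :: "nat \<Rightarrow> 'n::finite set"
  assumes part: "nest_partition L N"
    and par: "\<And>l. l \<in> {1..L} \<Longrightarrow> 0 < \<mu> l \<and> \<mu> l \<le> 1"
    and q: "q \<in> prob_simplex" and e: "0 < e" "e < 1"
  shows "nested_entropy L N \<mu> q + ln (1 - e) \<le> convex_conjugate (nested_logit_surplus L N \<mu>) q"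
proof -
  define u :: "real ^ 'n" where "u = (\<chi> i. 1 / real CARD('n))"
  have u: "u \<in> prob_simplex" by (simp add: u_def prob_simplex_def)
  \<comment> \<open>Mixing makes \<open>p\<close> strictly positive while keeping
    \<open>p $ i\<close> at least \<open>(1 - e) * q $ i\<close>.\<close>
  define p where "p = (1 - e) *\<^sub>R q + e *\<^sub>R u"
  define P where "P l = (\<Sum>i\<in>N l. p $ i)" for l
  define Q where "Q l = (\<Sum>i\<in>N l. q $ i)" for l
  define nest where "nest i = (SOME l. l \<in> {1..L} \<and> i \<in> N l)" for i
  have nest: "nest i = l" if "l \<in> {1..L}" "i \<in> N l" for i l
  proof -
    have "nest i \<in> {1..L} \<and> i \<in> N (nest i)"
      unfolding nest_def using someI[of "\<lambda>l. l \<in> {1..L} \<and> i \<in> N l" l] that by blast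
    then show ?thesis using nest_partition_unique[OF part] that by blast
  qed
  define v :: "real ^ 'n" where "v = (\<chi> i. \<mu> (nest i) * ln (p $ i) + (1 - \<mu> (nest i)) * ln (P (nest i)))"
  have v: "v $ i = \<mu> l * ln (p $ i) + (1 - \<mu> l) * ln (P l)" if "l \<in> {1..L}" "i \<in> N l" for i l
    using nest[OF that] by (simp add: v_def)
  have pS: "p \<in> prob_simplex"
    unfolding p_def using convexD[OF convex_prob_simplex q u, of "1 - e" e] e by simp
  have q0: "0 \<le> q $ i" for i using q by (simp add: prob_simplex_def)
  have p_ge: "(1 - e) * q $ i \<le> p $ i" for i using e by (simp add: p_def u_def)
  have p0: "0 < p $ i" for i
    using e q0[of i] by (auto simp: p_def u_def intro!: add_nonneg_pos)
  have P0: "0 < P l" if "l \<in> {1..L}" for l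
    unfolding P_def using that part by (intro sum_pos p0) (auto simp: nest_partition_def)
  have P_ge: "(1 - e) * Q l \<le> P l" for l
    unfolding P_def Q_def sum_distrib_left by (intro sum_mono p_ge)
  have Q0: "0 \<le> Q l" for l unfolding Q_def by (intro sum_nonneg q0)
  \<comment> \<open>The power \<open>(1 - \<mu> l) / \<mu> l\<close> of \<open>P l\<close> is a
    factor common to the nest; the remaining factors \<open>p $ i\<close> sum to
    \<open>P l\<close>.\<close>
  have "(\<Sum>i\<in>N l. exp (v $ i / \<mu> l)) powr \<mu> l = P l" if l: "l \<in> {1..L}" for l
  proof -
    have mu: "0 < \<mu> l" using par[OF l] by simp
    have "(\<Sum>i\<in>N l. exp (v $ i / \<mu> l)) = (\<Sum>i\<in>N l. p $ i * exp ((1 - \<mu> l) / \<mu> l * ln (P l)))"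
    proof (intro sum.cong refl)
      fix i assume i: "i \<in> N l"
      have "v $ i / \<mu> l = ln (p $ i) + (1 - \<mu> l) / \<mu> l * ln (P l)"
        unfolding v[OF l i] using mu by (simp add: field_simps)
      then show "exp (v $ i / \<mu> l) = p $ i * exp ((1 - \<mu> l) / \<mu> l * ln (P l))"
        using p0[of i] by (simp add: exp_add)
    qed
    also have "\<dots> = exp (ln (P l)) * exp ((1 - \<mu> l) / \<mu> l * ln (P l))"
      using P0[OF l] by (simp add: P_def flip: sum_distrib_right)
    also have "\<dots> = exp (ln (P l) / \<mu> l)"
      unfolding exp_add[symmetric] using mu by (simp add: field_simps)
    finally show ?thesis using mu P0[OF l] by (simp add: powr_def)
  qed
  then have Ev: "nested_logit_surplus L N \<mu> v = 0"
    unfolding nested_logit_surplus_def P_def using pS by (simp add: sum_nests[OF part] prob_simplex_def del: One_nat_def)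
  have ln_ge: "x * ln x + x * ln (1 - e) \<le> x * ln y" if "0 \<le> x" "0 < y" "(1 - e) * x \<le> y" for x y :: real
  proof (cases "x = 0")
    case False
    then have "ln ((1 - e) * x) \<le> ln y" using that e by simp
    then have "ln x + ln (1 - e) \<le> ln y" using False e that by (simp add: ln_mult)
    then have "x * (ln x + ln (1 - e)) \<le> x * ln y" using that(1) by (rule mult_left_mono)
    then show ?thesis by (simp add: algebra_simps)
  qed simp
  \<comment> \<open>The error \<open>ln (1 - e)\<close> enters with weights
    \<open>\<mu> l * Q l\<close> and \<open>(1 - \<mu> l) * Q l\<close>, in total
    \<open>Q l\<close>, hence with weight 1 over all nests.\<close>
  have nest_ge: "\<mu> l * (\<Sum>i\<in>N l. q $ i * ln (q $ i)) + (1 - \<mu> l) * (Q l * ln (Q l)) + Q l * ln (1 - e)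
      \<le> (\<Sum>i\<in>N l. v $ i * q $ i)" if l: "l \<in> {1..L}" for l
  proof -
    have "\<mu> l * (\<Sum>i\<in>N l. q $ i * ln (q $ i)) + (1 - \<mu> l) * (Q l * ln (Q l)) + Q l * ln (1 - e)
        = \<mu> l * (\<Sum>i\<in>N l. q $ i * ln (q $ i) + q $ i * ln (1 - e))
          + (1 - \<mu> l) * (Q l * ln (Q l) + Q l * ln (1 - e))"
      unfolding sum.distrib sum_distrib_right[symmetric] Q_def by (simp add: algebra_simps)
    also have "\<dots> \<le> \<mu> l * (\<Sum>i\<in>N l. q $ i * ln (p $ i)) + (1 - \<mu> l) * (Q l * ln (P l))"
      using par[OF l] P0[OF l]
      by (intro add_mono mult_left_mono sum_mono ln_ge q0 p0 p_ge Q0 P_ge) auto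
    also have "\<dots> = (\<Sum>i\<in>N l. v $ i * q $ i)"
      by (simp add: v[OF l] Q_def algebra_simps sum.distrib sum_distrib_left sum_subtractf)
    finally show ?thesis .
  qed
  have sumQ: "(\<Sum>l=1..L. Q l) = 1"
    unfolding Q_def sum_nests[OF part] using q by (simp add: prob_simplex_def)
  have "nested_entropy L N \<mu> q + ln (1 - e) = (\<Sum>l=1..L. \<mu> l * (\<Sum>i\<in>N l. q $ i * ln (q $ i))
      + (1 - \<mu> l) * (Q l * ln (Q l)) + Q l * ln (1 - e))"
    using sumQ by (simp add: nested_entropy_def Q_def sum.distrib flip: sum_distrib_right)
  also have "\<dots> \<le> (\<Sum>l=1..L. \<Sum>i\<in>N l. v $ i * q $ i)"
    by (intro sum_mono nest_ge)
  also have "\<dots> = v \<bullet> q - nested_logit_surplus L N \<mu> v"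
    by (simp add: Ev inner_vec_def sum_nests[OF part] del: One_nat_def)
  also have "\<dots> \<le> convex_conjugate (nested_logit_surplus L N \<mu>) q"
    unfolding convex_conjugate_def using par
    by (intro cSUP_upper bdd_above_conjugate_nested_logit part q) auto
  finally show ?thesis .
qed

lemma conjugate_nested_logit:
  fixes N :: "nat \<Rightarrow> 'n::finite set"
  assumes part: "nest_partition L N"
    and par: "\<And>l. l \<in> {1..L} \<Longrightarrow> 0 < \<mu> l \<and> \<mu> l \<le> 1"
    and q: "q \<in> prob_simplex"
  shows "convex_conjugate (nested_logit_surplus L N \<mu>) q = nested_entropy L N \<mu> q"
proof (rule antisym)
  show "convex_conjugate (nested_logit_surplus L N \<mu>) q \<le> nested_entropy L N \<mu> q"
    unfolding convex_conjugate_def using par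
    by (intro cSUP_least fenchel_young_nested_logit part q) auto
  \<comment> \<open>Letting \<open>e\<close> tend to 0 removes the error term.\<close>
  have "((\<lambda>e. nested_entropy L N \<mu> q + ln (1 - e)) \<longlongrightarrow> nested_entropy L N \<mu> q + ln (1 - 0)) (at_right 0)"
    by (intro tendsto_intros) auto
  moreover have "\<forall>\<^sub>F e in at_right 0. nested_entropy L N \<mu> q + ln (1 - e)
      \<le> convex_conjugate (nested_logit_surplus L N \<mu>) q"
    using conjugate_nested_logit_ge_perturbed[OF part par q]
    by (auto simp: eventually_at_right_field intro!: exI[of _ 1])
  ultimately show "nested_entropy L N \<mu> q \<le> convex_conjugate (nested_logit_surplus L N \<mu>) q"
    by (auto intro: tendsto_upperbound)
qed

section \<open>Strong convexity of the closed form\<close>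

lemma strongly_convex_nested_entropy:
  fixes N :: "nat \<Rightarrow> 'n::finite set"
  assumes part: "nest_partition L N"
    and b: "0 \<le> b" "\<And>l. l \<in> {1..L} \<Longrightarrow> b \<le> \<mu> l \<and> \<mu> l \<le> 1"
  shows "strongly_convex_on prob_simplex l1_norm (nested_entropy L N \<mu>) b"
  unfolding strongly_convex_on_def
proof (intro ballI)
  fix q q' :: "real ^ 'n" and t :: real
  assume q: "q \<in> prob_simplex" and q': "q' \<in> prob_simplex" and "t \<in> {0..1}"
  then have t: "0 \<le> t" "t \<le> 1" by auto
  define z where "z = t *\<^sub>R q + (1 - t) *\<^sub>R q'"
  define D where "D = l1_norm (q - q')"
  \<comment> \<open>The gain from \<open>x_ln_x_strong_convexity\<close> with
    \<open>r = D / 2\<close>. The weights in parentheses sum to 6, so the total gain for general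
    \<open>r\<close> is \<open>2 * r * D - 2 * r^2\<close>; this \<open>r\<close> maximizes it, with
    value \<open>D^2 / 2\<close>.\<close>
  define g where "g i = D * \<bar>q $ i - q' $ i\<bar>
    - (D / 2)\<^sup>2 * (2 * (1 - t) * q $ i + 2 * t * q' $ i + 4 * z $ i) / 3" for i
  have q0: "0 \<le> q $ i" "0 \<le> q' $ i" for i using q q' by (auto simp: prob_simplex_def)
  have zi: "z $ i = t * q $ i + (1 - t) * q' $ i" for i by (simp add: z_def)
  have zsum: "(\<Sum>i\<in>A. z $ i) = t * (\<Sum>i\<in>A. q $ i) + (1 - t) * (\<Sum>i\<in>A. q' $ i)" for A
    by (simp add: zi sum.distrib sum_distrib_left)
  have s1: "sum (($) q) UNIV = 1" "sum (($) q') UNIV = 1"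
    using q q' by (auto simp: prob_simplex_def)
  have "sum g UNIV = D * D - (D / 2)\<^sup>2 * (2 * (1 - t) * 1 + 2 * t * 1 + 4 * (t * 1 + (1 - t) * 1)) / 3"
    unfolding g_def zi
    by (simp add: sum.distrib sum_subtractf D_def l1_norm_def s1 flip: sum_distrib_left sum_divide_distrib)
  then have gsum: "sum g UNIV = D\<^sup>2 / 2" by (simp add: power2_eq_square field_simps)
  \<comment> \<open>Split \<open>c\<close> as \<open>b + (c - b)\<close>: strong convexity is used
    for the first share, plain convexity for the second.\<close>
  have alt: "c * (z $ i * ln (z $ i)) + b * (t * (1 - t) * g i)
      \<le> c * (t * (q $ i * ln (q $ i)) + (1 - t) * (q' $ i * ln (q' $ i)))" if "b \<le> c" for c i
  proof -
    let ?R = "t * (q $ i * ln (q $ i)) + (1 - t) * (q' $ i * ln (q' $ i))"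
    have "b * (z $ i * ln (z $ i) + t * (1 - t) * g i) \<le> b * ?R"
      using x_ln_x_strong_convexity[OF q0[of i] t, of "D / 2"] b(1)
      by (intro mult_left_mono) (simp_all add: zi g_def)
    moreover have "(c - b) * (z $ i * ln (z $ i)) \<le> (c - b) * ?R"
      using x_ln_x_convexity[OF q0[of i] t] that by (intro mult_left_mono) (simp_all add: zi)
    ultimately show ?thesis by (simp add: algebra_simps)
  qed
  have nest: "\<mu> l * (\<Sum>i\<in>N l. z $ i * ln (z $ i)) + (1 - \<mu> l) * ((\<Sum>i\<in>N l. z $ i) * ln (\<Sum>i\<in>N l. z $ i))
      + b * (t * (1 - t) * (\<Sum>i\<in>N l. g i))
    \<le> t * (\<mu> l * (\<Sum>i\<in>N l. q $ i * ln (q $ i)) + (1 - \<mu> l) * ((\<Sum>i\<in>N l. q $ i) * ln (\<Sum>i\<in>N l. q $ i)))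
      + (1 - t) * (\<mu> l * (\<Sum>i\<in>N l. q' $ i * ln (q' $ i))
          + (1 - \<mu> l) * ((\<Sum>i\<in>N l. q' $ i) * ln (\<Sum>i\<in>N l. q' $ i)))"
    if l: "l \<in> {1..L}" for l
  proof -
    have "(\<Sum>i\<in>N l. \<mu> l * (z $ i * ln (z $ i)) + b * (t * (1 - t) * g i))
      \<le> (\<Sum>i\<in>N l. \<mu> l * (t * (q $ i * ln (q $ i)) + (1 - t) * (q' $ i * ln (q' $ i))))"
      using b(2)[OF l] by (intro sum_mono alt) auto
    then have 1: "\<mu> l * (\<Sum>i\<in>N l. z $ i * ln (z $ i)) + b * (t * (1 - t) * (\<Sum>i\<in>N l. g i))
      \<le> \<mu> l * (t * (\<Sum>i\<in>N l. q $ i * ln (q $ i)) + (1 - t) * (\<Sum>i\<in>N l. q' $ i * ln (q' $ i)))"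
      by (simp add: sum.distrib flip: sum_distrib_left)
    have "(1 - \<mu> l) * ((\<Sum>i\<in>N l. z $ i) * ln (\<Sum>i\<in>N l. z $ i))
      \<le> (1 - \<mu> l) * (t * ((\<Sum>i\<in>N l. q $ i) * ln (\<Sum>i\<in>N l. q $ i))
          + (1 - t) * ((\<Sum>i\<in>N l. q' $ i) * ln (\<Sum>i\<in>N l. q' $ i)))"
      unfolding zsum using b(2)[OF l] t
      by (intro mult_left_mono x_ln_x_convexity sum_nonneg q0) auto
    with 1 show ?thesis by (simp add: algebra_simps)
  qed
  have "nested_entropy L N \<mu> z + b * (t * (1 - t) * (\<Sum>l=1..L. \<Sum>i\<in>N l. g i))
    \<le> t * nested_entropy L N \<mu> q + (1 - t) * nested_entropy L N \<mu> q'"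
    unfolding nested_entropy_def sum_distrib_left[of _ _ "{1..L}"] sum.distrib[symmetric]
    by (intro sum_mono nest)
  then show "nested_entropy L N \<mu> (t *\<^sub>R q + (1 - t) *\<^sub>R q') \<le> t * nested_entropy L N \<mu> q
      + (1 - t) * nested_entropy L N \<mu> q' - b / 2 * t * (1 - t) * (l1_norm (q - q'))\<^sup>2"
    unfolding sum_nests[OF part] gsum by (simp add: z_def D_def algebra_simps)
qed

section \<open>Sharpness on an edge of the simplex\<close>

text \<open>
  On the edge from \<open>i\<close> to \<open>j\<close> the function is the binary negative entropy scaled by \<open>c\<close>; its second
  derivative at the midpoint gives the bound.
\<close>

lemma strong_convexity_le_of_binary_entropy_edge:
  fixes f :: "real ^ 'n::finite \<Rightarrow> real"
  assumes sc: "strongly_convex_on prob_simplex l1_norm f \<gamma>" and ij: "i \<noteq> j"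
    and edge: "\<And>a. 0 \<le> a \<Longrightarrow> a \<le> 1 \<Longrightarrow>
      f (axis i a + axis j (1 - a)) = c * (a * ln a + (1 - a) * ln (1 - a))"
  shows "\<gamma> \<le> c"
proof -
  define e where "e a = (axis i a + axis j (1 - a) :: real ^ 'n)" for a
  have sum2: "(\<Sum>k\<in>UNIV. F k) = F i + F j" if "\<And>k. k \<noteq> i \<Longrightarrow> k \<noteq> j \<Longrightarrow> F k = 0" for F :: "'n \<Rightarrow> real"
  proof -
    have "(\<Sum>k\<in>UNIV. F k) = (\<Sum>k\<in>{i, j}. F k)"
      using that by (intro sum.mono_neutral_right) auto
    then show ?thesis using ij by simp
  qed
  have comp: "e a $ i = a" "e a $ j = 1 - a" "k \<noteq> i \<Longrightarrow> k \<noteq> j \<Longrightarrow> e a $ k = 0" for a k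
    using ij by (auto simp: e_def axis_def)
  have simplex: "e a \<in> prob_simplex" if "0 \<le> a" "a \<le> 1" for a
  proof -
    have "0 \<le> e a $ k" for k using comp(1,2)[of a] comp(3)[of k a] that by (cases "k = i"; cases "k = j") auto
    moreover have "(\<Sum>k\<in>UNIV. e a $ k) = 1" by (subst sum2) (simp_all add: comp)
    ultimately show ?thesis by (simp add: prob_simplex_def)
  qed
  \<comment> \<open>Test points \<open>(1 + u) / 2\<close> and \<open>(1 - u) / 2\<close> have equal
    values by symmetry, midpoint \<open>1 / 2\<close> and 1-norm distance \<open>2 * u\<close>. The
    numerator is \<open>u^2\<close> to leading order, so \<open>G\<close> tends to 1.\<close>
  define G :: "real \<Rightarrow> real" where
    "G u = ((1 + u) * ln (1 + u) + (1 - u) * ln (1 - u)) / u\<^sup>2" for u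
  have "\<gamma> \<le> c * G u" if u: "0 < u" "u < 1" for u
  proof -
    let ?a = "(1 + u) / 2" and ?b = "(1 - u) / 2"
    define X where "X = ?a * ln ?a + ?b * ln ?b"
    have mid: "(1 / 2) *\<^sub>R e ?a + (1 - 1 / 2) *\<^sub>R e ?b = e (1 / 2)"
      by (simp add: e_def vec_eq_iff axis_def field_simps)
    have "l1_norm (e ?a - e ?b) = \<bar>?a - ?b\<bar> + \<bar>(1 - ?a) - (1 - ?b)\<bar>"
      unfolding l1_norm_def by (subst sum2) (simp_all add: comp)
    also have "\<dots> = 2 * u"
      using u by (simp add: diff_divide_distrib[symmetric])
    finally have "l1_norm (e ?a - e ?b) = 2 * u" .
    moreover have "f ((1 / 2) *\<^sub>R e ?a + (1 - 1 / 2) *\<^sub>R e ?b) \<le> 1 / 2 * f (e ?a) + (1 - 1 / 2) * f (e ?b)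
        - \<gamma> / 2 * (1 / 2) * (1 - 1 / 2) * (l1_norm (e ?a - e ?b))\<^sup>2"
      by (rule sc[unfolded strongly_convex_on_def, rule_format]) (use u in \<open>auto intro!: simplex\<close>)
    moreover have "f (e (1 / 2)) = - c * ln 2"
      unfolding e_def by (subst edge) (simp_all add: ln_div)
    moreover have "f (e ?a) = c * X" "f (e ?b) = c * X"
    proof -
      have compl: "1 - ?a = ?b" "1 - ?b = ?a" by (simp_all add: field_simps)
      then show "f (e ?a) = c * X" "f (e ?b) = c * X"
        using edge[of ?a] edge[of ?b] u unfolding e_def X_def compl by auto
    qed
    ultimately have "\<gamma> * u\<^sup>2 / 2 \<le> c * (X + ln 2)"
      unfolding mid by (simp add: power_mult_distrib algebra_simps)
    also have "X + ln 2 = ((1 + u) * ln (1 + u) + (1 - u) * ln (1 - u)) / 2"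
      using u by (simp add: X_def ln_div field_simps)
    finally show ?thesis using u by (simp add: G_def field_simps)
  qed
  then have "\<forall>\<^sub>F u in at_right 0. \<gamma> \<le> c * G u"
    by (auto simp: eventually_at_right_field intro!: exI[of _ 1])
  moreover have "((\<lambda>u. c * G u) \<longlongrightarrow> c * 1) (at_right 0)"
    unfolding G_def by (intro tendsto_mult_left) real_asymp
  ultimately show ?thesis by (auto intro: tendsto_lowerbound)
qed

text \<open>Within one nest the nest mass is 1 and its term vanishes. If all parameters are 1, the
  mass terms have coefficient 0, so \<open>i\<close> and \<open>j\<close> may lie in different
  nests.\<close>

lemma nested_entropy_edge:
  fixes N :: "nat \<Rightarrow> 'n::finite set"
  assumes part: "nest_partition L N" and ij: "i \<noteq> j" and a: "0 \<le> a" "a \<le> 1"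
    and case_disj: "(l \<in> {1..L} \<and> i \<in> N l \<and> j \<in> N l \<and> \<mu> l = c) \<or> (c = 1 \<and> (\<forall>l\<in>{1..L}. \<mu> l = 1))"
  shows "nested_entropy L N \<mu> (axis i a + axis j (1 - a)) = c * (a * ln a + (1 - a) * ln (1 - a))"
proof -
  define q :: "real ^ 'n" where "q = axis i a + axis j (1 - a)"
  have comp: "q $ i = a" "q $ j = 1 - a" "k \<noteq> i \<Longrightarrow> k \<noteq> j \<Longrightarrow> q $ k = 0" for k
    using ij by (auto simp: q_def axis_def)
  have sum2: "(\<Sum>k\<in>A. F (q $ k)) = F a + F (1 - a)"
    if "i \<in> A" "j \<in> A" "F 0 = 0" for F :: "real \<Rightarrow> real" and A
  proof -
    have "(\<Sum>k\<in>A. F (q $ k)) = (\<Sum>k\<in>{i, j}. F (q $ k))"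
      using that comp(3) by (intro sum.mono_neutral_right) auto
    then show ?thesis using ij by (simp add: comp)
  qed
  show ?thesis
    using case_disj
  proof
    assume l: "l \<in> {1..L} \<and> i \<in> N l \<and> j \<in> N l \<and> \<mu> l = c"
    have zero: "q $ k = 0" if "l' \<in> {1..L} - {l}" "k \<in> N l'" for l' k
      using that l nest_partition_unique[OF part, of l _ l'] by (intro comp(3)) auto
    have "nested_entropy L N \<mu> q = (\<Sum>l\<in>{l}. \<mu> l * (\<Sum>i\<in>N l. q $ i * ln (q $ i))
       + (1 - \<mu> l) * ((\<Sum>i\<in>N l. q $ i) * ln (\<Sum>i\<in>N l. q $ i)))"
      unfolding nested_entropy_def using l zero by (intro sum.mono_neutral_right) auto
    then show ?thesis
      using l sum2[of "N l" "\<lambda>x. x * ln x"] sum2[of "N l" "\<lambda>x. x"] by (simp add: q_def)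
  next
    assume c: "c = 1 \<and> (\<forall>l\<in>{1..L}. \<mu> l = 1)"
    then have "nested_entropy L N \<mu> q = (\<Sum>l=1..L. \<Sum>i\<in>N l. q $ i * ln (q $ i))"
      unfolding nested_entropy_def by (intro sum.cong) auto
    then show ?thesis
      using c sum2[of UNIV "\<lambda>x. x * ln x"] by (simp add: sum_nests[OF part] q_def del: One_nat_def)
  qed
qed

section \<open>The modulus of the conjugate\<close>

text \<open>Convexity of \<open>S\<close> keeps the mixed points inside the set where
  \<open>f\<close> and \<open>g\<close> agree.\<close>

lemma strongly_convex_on_cong:
  assumes "convex S" "\<And>x. x \<in> S \<Longrightarrow> f x = g x"
  shows "strongly_convex_on S nrm f \<beta> \<longleftrightarrow> strongly_convex_on S nrm g \<beta>"
  unfolding strongly_convex_on_def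
  by (intro ball_cong refl) (use assms in \<open>auto simp: convexD\<close>)

text \<open>In a singleton nest the two terms of the closed form merge to \<open>x ln x\<close> for
  every parameter, so a minimum below 1 attained only at singletons would be invisible to the
  conjugate; \<open>nondegenerate\<close> excludes this. For a single alternative the simplex is a
  point and no biggest constant exists.\<close>

theorem lemma2p5:
  fixes N :: "nat \<Rightarrow> 'n::finite set" and \<mu> :: "nat \<Rightarrow> real" and L :: nat
  assumes nests: "nest_partition L N"
    and params: "\<And>l. l \<in> {1..L} \<Longrightarrow> 0 < \<mu> l \<and> \<mu> l \<le> 1"
    and two_alternatives: "2 \<le> CARD('n)"
    and nondegenerate: "\<exists>l\<in>{1..L}. \<mu> l = Min (\<mu> ` {1..L}) \<and> (2 \<le> card (N l) \<or> \<mu> l = 1)"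
  shows "is_strong_convexity_modulus prob_simplex l1_norm
           (convex_conjugate (nested_logit_surplus L N \<mu>)) (Min (\<mu> ` {1..L}))"
proof -
  define m where "m = Min (\<mu> ` {1..L})"
  obtain l where l: "l \<in> {1..L}" "\<mu> l = m" "2 \<le> card (N l) \<or> m = 1"
    using nondegenerate unfolding m_def by auto
  have m_le: "m \<le> \<mu> k" if "k \<in> {1..L}" for k using that by (simp add: m_def)
  have pos: "0 < m" using params[OF l(1)] l(2) by simp
  have eq: "strongly_convex_on prob_simplex l1_norm (convex_conjugate (nested_logit_surplus L N \<mu>)) \<beta>
      \<longleftrightarrow> strongly_convex_on prob_simplex l1_norm (nested_entropy L N \<mu>) \<beta>" for \<beta>
    by (intro strongly_convex_on_cong convex_prob_simplex conjugate_nested_logit nests params)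
  have two: "\<exists>i\<in>A. \<exists>j\<in>A. i \<noteq> j" if "2 \<le> card A" for A :: "'n set"
    using that card_le_Suc0_iff_eq[of A] by auto
  have "\<exists>i j. i \<noteq> j \<and> ((l \<in> {1..L} \<and> i \<in> N l \<and> j \<in> N l \<and> \<mu> l = m) \<or> (m = 1 \<and> (\<forall>l\<in>{1..L}. \<mu> l = 1)))"
    using l(3)
  proof
    assume "2 \<le> card (N l)"
    then show ?thesis using two[of "N l"] l by auto
  next
    assume "m = 1"
    \<comment> \<open>A minimum of 1 and the upper bound 1 force all parameters to be 1, so any two
      alternatives span a suitable edge.\<close>
    then have "\<forall>l\<in>{1..L}. \<mu> l = 1" using m_le params by (force intro: antisym)
    then show ?thesis using two[of UNIV] two_alternatives \<open>m = 1\<close> by auto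
  qed
  then obtain i j where ij: "i \<noteq> j"
    "(l \<in> {1..L} \<and> i \<in> N l \<and> j \<in> N l \<and> \<mu> l = m) \<or> (m = 1 \<and> (\<forall>l\<in>{1..L}. \<mu> l = 1))" by blast
  have "\<gamma> \<le> m" if "strongly_convex_on prob_simplex l1_norm (nested_entropy L N \<mu>) \<gamma>" for \<gamma>
    using that ij(1) nested_entropy_edge[OF nests ij(1) _ _ ij(2)]
    by (rule strong_convexity_le_of_binary_entropy_edge)
  moreover have "strongly_convex_on prob_simplex l1_norm (nested_entropy L N \<mu>) m"
    using m_le params pos by (intro strongly_convex_nested_entropy nests) auto
  ultimately show ?thesis
    using pos unfolding is_strong_convexity_modulus_def eq m_def by auto
qed

end
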